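(* Every cubical $4$-polytope is strongly $2$-linked; that is, its graph is strongly $2$-linked.
   Context: A cubical $4$-polytope is a convex polytope of dimension $4$ all of whose facets are combinatorially equivalent (isomorphic face lattice) to the $3$-dimensional cube. The graph of a polytope is the undirected graph formed by its vertices and edges. A graph $G$ is $k$-linked if it has at least $2k$ vertices and, for every set of $2k$ distinct vertices of $G$ and every partition of this set into $k$ pairs $\{s_1,t_1\},\ldots,\{s_k,t_k\}$, there exist $k$ pairwise vertex-disjoint paths $L_1,\ldots,L_k$ in $G$ such that $L_i$ joins $s_i$ and $t_i$ for each $i$. A graph $G$ is strongly $k$-linked if it has at least $2k+1$ vertices and, for every vertex $v$ of $G$, the subgraph $G-v$ (obtained by deleting $v$) is $k$-linked. *)

theory Defs
  imports "HOL-Analysis.Analysis" "Graph_Theory.Graph_Theory"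
begin

text \<open>The face lattice contains the empty face and the polytope itself,
  both of which satisfy \<^const>\<open>face_of\<close>.\<close>

definition combinatorially_equivalent ::
    "'a::euclidean_space set \<Rightarrow> 'b::euclidean_space set \<Rightarrow> bool" where
  "combinatorially_equivalent P Q \<longleftrightarrow>
     (\<exists>f. bij_betw f {F. F face_of P} {G. G face_of Q} \<and>
          (\<forall>F G. F face_of P \<longrightarrow> G face_of P \<longrightarrow> (f F \<subseteq> f G \<longleftrightarrow> F \<subseteq> G)))"

definition cubical_4_polytope :: "'a::euclidean_space set \<Rightarrow> bool" where
  "cubical_4_polytope P \<longleftrightarrow>
     polytope P \<and> aff_dim P = 4 \<and>
     (\<forall>F. F facet_of P \<longrightarrow> combinatorially_equivalent F (cbox 0 One :: (real^3) set))"

text \<open>Undirected graphs are symmetric digraphs, as in \<^locale>\<open>graph\<close>. No condition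
  \<open>u \<noteq> v\<close> is needed below, since \<^const>\<open>edge_of\<close> forces dimension one.\<close>

definition polytope_graph :: "'a::euclidean_space set \<Rightarrow> ('a, 'a \<times> 'a) pre_digraph" where
  "polytope_graph P = with_proj
     \<lparr> pverts = {v. v extreme_point_of P},
       parcs = {(u, v). closed_segment u v edge_of P} \<rparr>"

lemma graph_polytope_graph:
  assumes "polytope P"
  shows "graph (polytope_graph P)"
proof -
  let ?G = "\<lparr> pverts = {v. v extreme_point_of P},
       parcs = {(u, v). closed_segment u v edge_of P} \<rparr>"
  have fin: "finite {v. v extreme_point_of P}"
    using assms by (simp add: finite_polyhedron_extreme_points polytope_imp_polyhedron)
  have ends: "u extreme_point_of P \<and> v extreme_point_of P \<and> u \<noteq> v"
    if "closed_segment u v edge_of P" for u v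
  proof -
    have face: "closed_segment u v face_of P" and dim: "aff_dim (closed_segment u v) = 1"
      using that by (auto simp: edge_of_def)
    show ?thesis
      using extreme_point_of_face[OF face] dim
      by (auto simp: extreme_point_of_segment)
  qed
  have sub: "parcs ?G \<subseteq> {v. v extreme_point_of P} \<times> {v. v extreme_point_of P}"
    using ends by auto
  have "finite (parcs ?G)"
    using finite_subset[OF sub] fin by blast
  moreover have "symmetric (with_proj ?G)"
    by (auto simp: symmetric_def sym_def closed_segment_commute)
  ultimately have "pair_graph ?G"
    using fin ends by unfold_locales auto
  then interpret pair_graph ?G .
  show ?thesis
    unfolding polytope_graph_def by (rule graph_axioms)
qed

text \<open>The two notions below are meant for finite graphs: \<^const>\<open>card\<close> is 0 on infinite sets.
  The functions \<open>s\<close>, \<open>t\<close> enumerate \<open>2 * k\<close> distinct vertices together with a partition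
  into the pairs \<open>{s i, t i}\<close>.\<close>

definition k_linked :: "nat \<Rightarrow> ('a, 'b) pre_digraph \<Rightarrow> bool" where
  "k_linked k G \<longleftrightarrow>
     2 * k \<le> card (verts G) \<and>
     (\<forall>s t. s ` {..<k} \<subseteq> verts G \<and> t ` {..<k} \<subseteq> verts G \<and>
            inj_on s {..<k} \<and> inj_on t {..<k} \<and> s ` {..<k} \<inter> t ` {..<k} = {} \<longrightarrow>
        (\<exists>L. (\<forall>i<k. vpath (L i) G \<and> hd (L i) = s i \<and> last (L i) = t i) \<and>
             disjoint_family_on (\<lambda>i. set (L i)) {..<k}))"

definition strongly_k_linked :: "nat \<Rightarrow> ('a, 'b) pre_digraph \<Rightarrow> bool" where
  "strongly_k_linked k G \<longleftrightarrow>
     2 * k + 1 \<le> card (verts G) \<and>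
     (\<forall>v \<in> verts G. k_linked k (pre_digraph.del_vert G v))"

end

theory Submission
  imports Defs
begin

text \<open>
  Fix five distinct vertices \<open>v\<close>, \<open>s1\<close>, \<open>t1\<close>, \<open>s2\<close>, \<open>t2\<close> of a cubical 4-polytope \<open>P\<close>. The two
  paths are found by placing a hyperplane through \<open>v\<close> and letting the simplex algorithm walk on
  its two sides. The tool is that the vertices strictly beyond any hyperplane span a connected
  subgraph (\<open>open_halfspace_joined\<close>), and that a vertex on the hyperplane has a neighbour on
  each side that \<open>P\<close> reaches (\<open>improving_edge\<close>).

  If the four vectors from \<open>v\<close> to the other vertices are linearly independent, some hyperplane
  through \<open>v\<close> has \<open>s1\<close>, \<open>t1\<close> strictly above and \<open>s2\<close>, \<open>t2\<close> strictly below, so one path runs above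
  it and the other below. If they are dependent, their span has smaller dimension than \<open>P\<close>, and
  all five vertices lie on a hyperplane \<open>H\<close> not containing \<open>P\<close>
  (\<open>separated_or_cohyperplanar\<close>). If \<open>P\<close> has points on both sides of \<open>H\<close>, connect \<open>s1\<close> to \<open>t1\<close>
  by stepping off \<open>H\<close> upwards, and \<open>s2\<close> to \<open>t2\<close> by stepping off downwards; the vertex \<open>v\<close> stays on
  \<open>H\<close>.

  Otherwise \<open>H\<close> supports \<open>P\<close>, so all five vertices lie in one facet \<open>F\<close>, and only here does
  cubicality enter. One pair can always be joined outside \<open>F\<close>, so it suffices to join the other
  pair inside \<open>F\<close> avoiding three vertices. Three vertices disconnect the cube graph only if they
  are the neighbourhood of a vertex, and the bipartition of the cube excludes that both choices of
  the inner pair are blocked in this way (\<open>cube_one_pair_joined\<close>).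
\<close>

section \<open>Walking uphill in the graph of a polytope\<close>

definition joined_within :: "'a::euclidean_space set \<Rightarrow> 'a set \<Rightarrow> 'a \<Rightarrow> 'a \<Rightarrow> bool" where
  "joined_within P A = (\<lambda>u w. closed_segment u w edge_of P \<and> u \<in> A \<and> w \<in> A)\<^sup>*\<^sup>*"

lemma joined_within_refl [simp]: "joined_within P A u u"
  by (simp add: joined_within_def)

lemma joined_within_edge:
  "closed_segment u w edge_of P \<Longrightarrow> u \<in> A \<Longrightarrow> w \<in> A \<Longrightarrow> joined_within P A u w"
  by (auto simp: joined_within_def)

lemma joined_within_trans:
  "joined_within P A u v \<Longrightarrow> joined_within P A v w \<Longrightarrow> joined_within P A u w"
  unfolding joined_within_def by (rule rtranclp_trans)

lemma joined_within_sym: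
  assumes "joined_within P A u w"
  shows "joined_within P A w u"
proof -
  have "symp (\<lambda>u w. closed_segment u w edge_of P \<and> u \<in> A \<and> w \<in> A)"
    by (auto simp: symp_def closed_segment_commute)
  from symp_rtranclp[OF this] assms show ?thesis
    unfolding joined_within_def by (blast dest: sympD)
qed

lemma joined_within_mono:
  assumes "joined_within P A u w" "A \<subseteq> B"
  shows "joined_within P B u w"
  using assms(1) unfolding joined_within_def
  by (rule rtranclp_mono[THEN predicate2D, rotated]) (use assms(2) in auto)

lemma joined_within_face:
  assumes "joined_within F A u w" "F face_of P"
  shows "joined_within P A u w"
  using assms(1) unfolding joined_within_def
  by (rule rtranclp_mono[THEN predicate2D, rotated])
    (use assms(2) in \<open>auto simp: edge_of_def intro: face_of_trans\<close>)

lemma edge_ends_extreme: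
  assumes "closed_segment u w edge_of P"
  shows "u extreme_point_of P" "w extreme_point_of P" "u \<noteq> w"
  using assms extreme_point_of_face[of "closed_segment u w" P]
  by (auto simp: edge_of_def extreme_point_of_segment)

lemma polytope_finite_extreme:
  fixes P :: "'a::euclidean_space set"
  shows "polytope P \<Longrightarrow> finite {v. v extreme_point_of P}"
  by (simp add: finite_polyhedron_extreme_points polytope_imp_polyhedron)

lemma polytope_hull_extreme:
  fixes P :: "'a::euclidean_space set"
  shows "polytope P \<Longrightarrow> P = convex hull {v. v extreme_point_of P}"
  by (simp add: Krein_Milman_Minkowski polytope_imp_compact polytope_imp_convex)

text \<open>A smallest face properly containing the vertex is an edge: in dimension at least two, a facet
  through the vertex is again larger than the vertex, so the induction descends to dimension one,
  where the polytope is a segment.\<close>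
lemma vertex_has_edge:
  fixes P :: "'a::euclidean_space set"
  assumes P: "polytope P" and x: "x extreme_point_of P" and ne: "P \<noteq> {x}"
  shows "\<exists>w. closed_segment x w edge_of P"
  using assms
proof (induction "nat (aff_dim P)" arbitrary: P rule: less_induct)
  case less
  have xP: "{x} face_of P" using less.prems by (simp add: face_of_singleton)
  obtain F where F: "F facet_of P" "{x} \<subseteq> F"
    using face_of_polyhedron_subset_facet[OF polytope_imp_polyhedron[OF less.prems(1)] xP] less.prems
    by auto
  have FP: "F face_of P" using F by (simp add: facet_of_imp_face_of)
  have xF: "x extreme_point_of F" using extreme_point_of_face[OF FP] F less.prems by simp
  have dimF: "aff_dim F = aff_dim P - 1" "F \<noteq> {}" using F by (auto simp: facet_of_def)
  show ?case
  proof (cases "F = {x}")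
    case True
    then have dim: "aff_dim P = 1" using dimF by simp
    then have "collinear P" "P \<noteq> {}" using F FP face_of_imp_subset by (auto simp: collinear_aff_dim)
    then obtain a b where ab: "P = closed_segment a b"
      using compact_convex_collinear_segment[of P] less.prems(1)
        polytope_imp_compact polytope_imp_convex by blast
    then have "x = a \<or> x = b" using less.prems(2) by (simp add: extreme_point_of_segment)
    moreover have "P edge_of P"
      using dim less.prems(1) by (simp add: edge_of_def face_of_refl polytope_imp_convex)
    ultimately show ?thesis using ab by (auto simp: closed_segment_commute)
  next
    case False
    have "aff_dim F \<ge> 0"
      using dimF(2) aff_dim_geq[of F] aff_dim_empty[of F] by linarith
    then have "nat (aff_dim F) < nat (aff_dim P)" using dimF by simp
    from less.hyps[OF this face_of_polytope_polytope[OF less.prems(1) FP] xF False]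
    show ?thesis using FP by (auto simp: edge_of_def intro: face_of_trans)
  qed
qed

lemma vertex_exposed:
  fixes P :: "'a::euclidean_space set"
  assumes "polytope P" "x extreme_point_of P"
  obtains c where "\<And>z. z \<in> P \<Longrightarrow> z \<noteq> x \<Longrightarrow> c \<bullet> z < c \<bullet> x"
proof -
  have "{x} exposed_face_of P"
    using assms by (simp add: exposed_face_of_polyhedron polytope_imp_polyhedron face_of_singleton)
  then obtain c b where "P \<subseteq> {z. c \<bullet> z \<le> b}" "{x} = P \<inter> {z. c \<bullet> z = b}"
    unfolding exposed_face_of_def by blast
  moreover from this have "c \<bullet> x = b" by blast
  ultimately have "c \<bullet> z < c \<bullet> x" if "z \<in> P" "z \<noteq> x" for z
    using that by (auto simp: order.strict_iff_order)
  then show ?thesis by (rule that)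
qed

lemma improving_vertex:
  fixes P :: "'a::euclidean_space set"
  assumes P: "polytope P" and y: "y \<in> P" "a \<bullet> x < a \<bullet> y"
  shows "\<exists>z. z extreme_point_of P \<and> a \<bullet> x < a \<bullet> z"
proof (rule ccontr)
  assume "\<not> ?thesis"
  then have "{z. z extreme_point_of P} \<subseteq> {z. a \<bullet> z \<le> a \<bullet> x}" by force
  then have "convex hull {z. z extreme_point_of P} \<subseteq> {z. a \<bullet> z \<le> a \<bullet> x}"
    by (rule hull_minimal) (rule convex_halfspace_le)
  then show False using y polytope_hull_extreme[OF P] by auto
qed

text \<open>The step of the simplex algorithm. With \<open>c\<close> exposing the vertex \<open>x\<close>, the functional
  \<open>a + l c\<close> is maximal at \<open>x\<close> for all large \<open>l\<close>; at the smallest such \<open>l\<close> the maximum is attained on a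
  face larger than \<open>x\<close>. On that face any gain in \<open>a\<close> equals \<open>l\<close> times the loss in \<open>c\<close>, so every
  other vertex of it improves \<open>a\<close> and any edge of it at \<open>x\<close> will do.\<close>
lemma improving_edge:
  fixes P :: "'a::euclidean_space set"
  assumes P: "polytope P" and x: "x extreme_point_of P" and y: "y \<in> P" "a \<bullet> x < a \<bullet> y"
  obtains w where "closed_segment x w edge_of P" "a \<bullet> x < a \<bullet> w"
proof -
  obtain c where c: "\<And>z. z \<in> P \<Longrightarrow> z \<noteq> x \<Longrightarrow> c \<bullet> z < c \<bullet> x"
    using vertex_exposed[OF P x] by blast
  define V where "V = {z. z extreme_point_of P} - {x}"
  \<comment> \<open>the value of \<open>l\<close> from which on \<open>z\<close> no longer beats \<open>x\<close>\<close>
  define r where "r z = (a \<bullet> z - a \<bullet> x) / (c \<bullet> x - c \<bullet> z)" for z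
  define l where "l = Max (r ` V)"
  have VP: "z \<in> P" "z \<noteq> x" "0 < c \<bullet> x - c \<bullet> z" if "z \<in> V" for z
    using that c by (auto simp: V_def extreme_point_of_def)
  obtain z0 where z0: "z0 \<in> V" "a \<bullet> x < a \<bullet> z0"
    using improving_vertex[OF P y] by (auto simp: V_def)
  have finV: "finite V" using polytope_finite_extreme[OF P] by (simp add: V_def)
  have rl: "r z \<le> l" if "z \<in> V" for z using that finV by (simp add: l_def)
  have "0 < r z0" using z0 VP[OF z0(1)] by (simp add: r_def)
  then have l: "0 < l" using rl[OF z0(1)] by simp
  obtain m where m: "m \<in> V" "r m = l"
    using Max_in[of "r ` V"] finV z0 unfolding l_def by fastforce
  define E where "E = P \<inter> {z. (a + l *\<^sub>R c) \<bullet> z = (a + l *\<^sub>R c) \<bullet> x}"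
  have "z \<in> {z. (a + l *\<^sub>R c) \<bullet> z \<le> (a + l *\<^sub>R c) \<bullet> x}" if "z extreme_point_of P" for z
  proof (cases "z = x")
    case False
    then have zV: "z \<in> V" using that by (simp add: V_def)
    then have "a \<bullet> z - a \<bullet> x \<le> l * (c \<bullet> x - c \<bullet> z)"
      using rl[OF zV] VP(3)[OF zV] by (simp add: r_def divide_le_eq)
    then show ?thesis by (simp add: inner_add_left algebra_simps)
  qed simp
  then have "convex hull {z. z extreme_point_of P} \<subseteq> {z. (a + l *\<^sub>R c) \<bullet> z \<le> (a + l *\<^sub>R c) \<bullet> x}"
    by (intro hull_minimal convex_halfspace_le) blast
  then have EP: "E face_of P"
    unfolding E_def using polytope_hull_extreme[OF P]
    by (intro face_of_Int_supporting_hyperplane_le polytope_imp_convex P) blast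
  have xE: "x extreme_point_of E"
    using x extreme_point_of_face[OF EP] by (simp add: E_def extreme_point_of_def)
  have "a \<bullet> m - a \<bullet> x = l * (c \<bullet> x - c \<bullet> m)"
    using m(2) VP(3)[OF m(1)] by (auto simp: r_def divide_simps)
  then have "m \<in> E" using VP(1)[OF m(1)] by (simp add: E_def inner_add_left algebra_simps)
  then have "E \<noteq> {x}" using VP(2)[OF m(1)] by blast
  then obtain w where w: "closed_segment x w edge_of E"
    using vertex_has_edge[OF face_of_polytope_polytope[OF P EP] xE] by blast
  then have "w \<in> E" "w \<noteq> x" using edge_ends_extreme[OF w] by (auto simp: extreme_point_of_def)
  then have "a \<bullet> w - a \<bullet> x = l * (c \<bullet> x - c \<bullet> w)" "0 < c \<bullet> x - c \<bullet> w"
    using c[of w] by (auto simp: E_def inner_add_left algebra_simps)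
  then have "a \<bullet> x < a \<bullet> w" using mult_pos_pos[OF l, of "c \<bullet> x - c \<bullet> w"] by linarith
  moreover have "closed_segment x w edge_of P"
    using w EP by (auto simp: edge_of_def intro: face_of_trans)
  ultimately show ?thesis using that by blast
qed

lemma climb_to_maximum:
  fixes P :: "'a::euclidean_space set"
  assumes P: "polytope P" and u: "u extreme_point_of P"
  shows "\<exists>m. m extreme_point_of P \<and> (\<forall>z\<in>P. a \<bullet> z \<le> a \<bullet> m)
    \<and> joined_within P {z. z extreme_point_of P \<and> a \<bullet> u \<le> a \<bullet> z} u m"
  using u
proof (induction "card {z. z extreme_point_of P \<and> a \<bullet> u < a \<bullet> z}" arbitrary: u rule: less_induct)
  case less
  show ?case
  proof (cases "\<forall>z\<in>P. a \<bullet> z \<le> a \<bullet> u")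
    case False
    then obtain y where "y \<in> P" "a \<bullet> u < a \<bullet> y" by force
    then obtain w where w: "closed_segment u w edge_of P" "a \<bullet> u < a \<bullet> w"
      using improving_edge[OF P less.prems] by blast
    have wx: "w extreme_point_of P" using edge_ends_extreme[OF w(1)] by simp
    have "{z. z extreme_point_of P \<and> a \<bullet> w < a \<bullet> z} \<subset> {z. z extreme_point_of P \<and> a \<bullet> u < a \<bullet> z}"
      using w wx by auto
    then have "card {z. z extreme_point_of P \<and> a \<bullet> w < a \<bullet> z} < card {z. z extreme_point_of P \<and> a \<bullet> u < a \<bullet> z}"
      using polytope_finite_extreme[OF P] by (intro psubset_card_mono) auto
    from less.hyps[OF this wx] obtain m where m: "m extreme_point_of P" "\<forall>z\<in>P. a \<bullet> z \<le> a \<bullet> m"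
      "joined_within P {z. z extreme_point_of P \<and> a \<bullet> w \<le> a \<bullet> z} w m" by blast
    have "joined_within P {z. z extreme_point_of P \<and> a \<bullet> u \<le> a \<bullet> z} w m"
      by (rule joined_within_mono[OF m(3)]) (use w in auto)
    moreover have "joined_within P {z. z extreme_point_of P \<and> a \<bullet> u \<le> a \<bullet> z} u w"
      using w wx less.prems by (intro joined_within_edge) auto
    ultimately show ?thesis using m joined_within_trans by blast
  qed (use less.prems in auto)
qed

text \<open>Climbing along a functional that exposes \<open>w\<close> can only end in \<open>w\<close>.\<close>
lemma polytope_graph_connected:
  fixes P :: "'a::euclidean_space set"
  assumes P: "polytope P" and u: "u extreme_point_of P" and w: "w extreme_point_of P"
  shows "joined_within P {z. z extreme_point_of P} u w"
proof -
  obtain c where c: "\<And>z. z \<in> P \<Longrightarrow> z \<noteq> w \<Longrightarrow> c \<bullet> z < c \<bullet> w"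
    using vertex_exposed[OF P w] by blast
  obtain m where m: "m extreme_point_of P" "\<forall>z\<in>P. c \<bullet> z \<le> c \<bullet> m"
    "joined_within P {z. z extreme_point_of P \<and> c \<bullet> u \<le> c \<bullet> z} u m"
    using climb_to_maximum[OF P u] by blast
  have "m = w" using m w c[of m] by (force simp: extreme_point_of_def)
  moreover have "joined_within P {z. z extreme_point_of P} u m"
    by (rule joined_within_mono[OF m(3)]) auto
  ultimately show ?thesis by simp
qed

text \<open>From both vertices one climbs to the face on which \<open>a\<close> is maximal; this face is a polytope, so
  its own graph is connected, and none of these walks ever goes below its starting level.\<close>
lemma open_halfspace_joined:
  fixes P :: "'a::euclidean_space set"
  assumes P: "polytope P" and u: "u extreme_point_of P" "b < a \<bullet> u" and w: "w extreme_point_of P" "b < a \<bullet> w"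
  shows "joined_within P {z. z extreme_point_of P \<and> b < a \<bullet> z} u w" (is "joined_within P ?A u w")
proof -
  obtain m where m: "m extreme_point_of P" "\<forall>z\<in>P. a \<bullet> z \<le> a \<bullet> m"
    "joined_within P {z. z extreme_point_of P \<and> a \<bullet> u \<le> a \<bullet> z} u m"
    using climb_to_maximum[OF P u(1)] by blast
  obtain n where n: "n extreme_point_of P" "\<forall>z\<in>P. a \<bullet> z \<le> a \<bullet> n"
    "joined_within P {z. z extreme_point_of P \<and> a \<bullet> w \<le> a \<bullet> z} w n"
    using climb_to_maximum[OF P w(1)] by blast
  define T where "T = P \<inter> {z. a \<bullet> z = a \<bullet> m}"
  have T: "T face_of P"
    unfolding T_def using m(2) P
    by (intro face_of_Int_supporting_hyperplane_le) (auto simp: polytope_imp_convex)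
  have mP: "m \<in> P" "n \<in> P" using m(1) n(1) by (auto simp: extreme_point_of_def)
  then have "a \<bullet> n = a \<bullet> m" using m(2) n(2) by (auto intro: order_antisym)
  then have mT: "m extreme_point_of T" "n extreme_point_of T"
    unfolding extreme_point_of_face[OF T] using m(1) n(1) mP by (auto simp: T_def)
  have TA: "{z. z extreme_point_of T} \<subseteq> ?A"
  proof
    fix z assume "z \<in> {z. z extreme_point_of T}"
    then have "z extreme_point_of P" "a \<bullet> z = a \<bullet> m" unfolding T_def[symmetric] extreme_point_of_face[OF T] by (auto simp: extreme_point_of_face[OF T]) (simp_all add: T_def)
    moreover have "a \<bullet> u \<le> a \<bullet> m" using m(2) u(1) by (auto simp: extreme_point_of_def)
    ultimately show "z \<in> ?A" using u by auto
  qed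
  have middle: "joined_within P ?A m n"
    using joined_within_mono[OF joined_within_face[OF polytope_graph_connected[OF
       face_of_polytope_polytope[OF P T] mT] T] TA] .
  have first: "joined_within P ?A u m" by (rule joined_within_mono[OF m(3)]) (use u in auto)
  have last: "joined_within P ?A w n" by (rule joined_within_mono[OF n(3)]) (use w in auto)
  show ?thesis
    by (rule joined_within_trans[OF joined_within_trans[OF first middle] joined_within_sym[OF last]])
qed

text \<open>The form used for vertices on a hyperplane: each takes one improving edge, and the rest of
  the walk stays in the open halfspace, away from all other vertices on the hyperplane.\<close>
lemma joined_beyond_hyperplane:
  fixes P :: "'a::euclidean_space set"
  assumes P: "polytope P" and u: "u extreme_point_of P" "a \<bullet> u = b" and w: "w extreme_point_of P" "a \<bullet> w = b"
    and y: "y \<in> P" "b < a \<bullet> y"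
  shows "joined_within P ({u, w} \<union> {z. z extreme_point_of P \<and> b < a \<bullet> z}) u w" (is "joined_within P ?B u w")
proof -
  obtain u' where u': "closed_segment u u' edge_of P" "b < a \<bullet> u'"
    using improving_edge[OF P u(1) y(1), of a] y(2) unfolding u(2) by blast
  obtain w' where w': "closed_segment w w' edge_of P" "b < a \<bullet> w'"
    using improving_edge[OF P w(1) y(1), of a] y(2) unfolding w(2) by blast
  have ex: "u' extreme_point_of P" "w' extreme_point_of P" using edge_ends_extreme u' w' by blast+
  have middle: "joined_within P ?B u' w'"
    by (rule joined_within_mono[OF open_halfspace_joined[OF P ex(1) u'(2) ex(2) w'(2)]]) auto
  have first: "joined_within P ?B u u'" using u' ex by (intro joined_within_edge) auto
  have last: "joined_within P ?B w w'" using w' ex by (intro joined_within_edge) auto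
  show ?thesis
    by (rule joined_within_trans[OF joined_within_trans[OF first middle] joined_within_sym[OF last]])
qed

section \<open>Separating triples in the cube graph\<close>

definition cube_nbrs :: "bool \<times> bool \<times> bool \<Rightarrow> (bool \<times> bool \<times> bool) set" where
  "cube_nbrs = (\<lambda>(a, b, c). {(\<not> a, b, c), (a, \<not> b, c), (a, b, \<not> c)})"

definition cube_parity :: "bool \<times> bool \<times> bool \<Rightarrow> bool" where
  "cube_parity = (\<lambda>(a, b, c). a = (b = c))"

lemma cube_nbrs_parity: "q \<in> cube_nbrs p \<Longrightarrow> cube_parity q \<noteq> cube_parity p"
  by (auto simp: cube_nbrs_def cube_parity_def split: prod.splits)

lemma card_cube_nbrs: "card (cube_nbrs p) = 3"
  by (auto simp: cube_nbrs_def split: prod.splits)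

text \<open>An edge of the cube has four outer neighbours, since the graph has no triangle. Hence three
  deleted vertices cannot isolate an edge.\<close>
lemma card_cube_nbrs_edge:
  assumes "q \<in> cube_nbrs p"
  shows "card ((cube_nbrs p \<union> cube_nbrs q) - {p, q}) = 4"
proof -
  have "cube_nbrs p \<inter> cube_nbrs q = {}"
    using cube_nbrs_parity[OF assms] by (metis (full_types) cube_nbrs_parity disjoint_iff)
  moreover have "p \<in> cube_nbrs q" "p \<notin> cube_nbrs p" "q \<notin> cube_nbrs q"
    using assms by (auto simp: cube_nbrs_def split: prod.splits)
  ultimately have "(cube_nbrs p \<union> cube_nbrs q) - {p, q} = (cube_nbrs p - {q}) \<union> (cube_nbrs q - {p})"
    "(cube_nbrs p - {q}) \<inter> (cube_nbrs q - {p}) = {}" by auto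
  then show ?thesis
    using assms \<open>p \<in> cube_nbrs q\<close>
    by (simp add: card_Un_disjoint card_cube_nbrs)
qed

abbreviation cube_joined :: "(bool \<times> bool \<times> bool) set \<Rightarrow> bool \<times> bool \<times> bool \<Rightarrow> bool \<times> bool \<times> bool \<Rightarrow> bool"
  where "cube_joined S \<equiv> (\<lambda>p q. q \<in> cube_nbrs p \<and> p \<notin> S \<and> q \<notin> S)\<^sup>*\<^sup>*"

lemma cube_small_component:
  assumes "p \<notin> T" "card T = 3" "card {q. cube_joined T p q} \<le> 2"
  shows "cube_nbrs p = T"
proof -
  let ?X = "{q. cube_joined T p q}"
  have "cube_nbrs p \<subseteq> T"
  proof (rule ccontr)
    assume "\<not> cube_nbrs p \<subseteq> T"
    then obtain q where q: "q \<in> cube_nbrs p" "q \<notin> T" by blast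
    have "cube_joined T p q" using assms(1) q by (intro r_into_rtranclp) auto
    then have sub: "{p, q} \<subseteq> ?X" by auto
    have "p \<noteq> q" using q cube_nbrs_parity by blast
    then have eq: "?X = {p, q}"
      using sub assms(3) by (intro card_seteq[symmetric]) auto
    have "(cube_nbrs p \<union> cube_nbrs q) - {p, q} \<subseteq> T"
    proof
      fix r assume r: "r \<in> (cube_nbrs p \<union> cube_nbrs q) - {p, q}"
      show "r \<in> T"
      proof (rule ccontr)
        assume "r \<notin> T"
        with r assms(1) q have "cube_joined T p r"
          using \<open>cube_joined T p q\<close> by (auto intro: rtranclp.rtrancl_into_rtrancl)
        with eq r show False by blast
      qed
    qed
    then have "4 \<le> card T"
      using card_cube_nbrs_edge[OF q(1)] by (metis card_mono finite)
    with assms(2) show False by simp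
  qed
  then show ?thesis by (simp add: assms(2) card_cube_nbrs card_subset_eq)
qed

lemma cube_joined_sym: "cube_joined T p q \<Longrightarrow> cube_joined T q p"
proof (induction rule: rtranclp_induct)
  case (step y z)
  then have "y \<in> cube_nbrs z" by (auto simp: cube_nbrs_def split: prod.splits)
  with step show ?case by (intro converse_rtranclp_into_rtranclp[of _ z y]) auto
qed auto

text \<open>Five vertices remain after deleting three, so if \<open>p\<close> and \<open>q\<close> are separated, one of their two
  components has at most two vertices. It is not an edge, so it is a single vertex whose
  neighbourhood has been deleted.\<close>
lemma cube_separator:
  assumes "p \<notin> T" "q \<notin> T" "card T = 3" "\<not> cube_joined T p q"
  shows "cube_nbrs p = T \<or> cube_nbrs q = T"
proof -
  define X Y where "X = {r. cube_joined T p r}" and "Y = {r. cube_joined T q r}"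
  have off: "r \<notin> T" if "cube_joined T x r" "x \<notin> T" for x r
    using that by (induction rule: rtranclp_induct) auto
  have "X \<inter> T = {}" "Y \<inter> T = {}"
    using off assms(1,2) unfolding X_def Y_def by blast+
  moreover have "X \<inter> Y = {}"
  proof (intro equals0I)
    fix r assume "r \<in> X \<inter> Y"
    then have r: "cube_joined T p r" "cube_joined T q r" by (simp_all add: X_def Y_def)
    show False
      using assms(4) rtranclp_trans[OF r(1) cube_joined_sym[OF r(2)]] by contradiction
  qed
  ultimately have "card X + card Y + card T = card (X \<union> Y \<union> T)"
    by (simp add: card_Un_disjoint Int_Un_distrib2)
  also have "\<dots> \<le> card (UNIV :: (bool \<times> bool \<times> bool) set)" by (rule card_mono) auto
  also have "\<dots> = 8" by (simp add: card_UNIV_bool flip: UNIV_Times_UNIV)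
  finally have "card X \<le> 2 \<or> card Y \<le> 2" using assms(3) by linarith
  then show ?thesis
    using cube_small_component[OF assms(1,3)] cube_small_component[OF assms(2,3)]
    unfolding X_def Y_def by blast
qed

text \<open>If both pairs were blocked, some \<open>p \<in> {s1, t1}\<close> would be adjacent to \<open>v\<close>, \<open>s2\<close>, \<open>t2\<close>, and some
  \<open>q \<in> {s2, t2}\<close> adjacent to \<open>v\<close>, \<open>s1\<close>, \<open>t1\<close>. Then \<open>v\<close>, \<open>p\<close>, \<open>q\<close> form a triangle in a bipartite
  graph.\<close>
lemma cube_one_pair_joined:
  assumes d: "distinct [v, s1, t1, s2, t2]"
  shows "cube_joined {v, s2, t2} s1 t1 \<or> cube_joined {v, s1, t1} s2 t2"
proof (rule ccontr)
  assume neg: "\<not> ?thesis"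
  have "cube_nbrs s1 = {v, s2, t2} \<or> cube_nbrs t1 = {v, s2, t2}"
    by (rule cube_separator) (use neg d in auto)
  then obtain p where p: "p \<in> {s1, t1}" "{v, s2, t2} \<subseteq> cube_nbrs p" by blast
  have "cube_nbrs s2 = {v, s1, t1} \<or> cube_nbrs t2 = {v, s1, t1}"
    by (rule cube_separator) (use neg d in auto)
  then obtain q where q: "q \<in> {s2, t2}" "{v, s1, t1} \<subseteq> cube_nbrs q" by blast
  have "v \<in> cube_nbrs p" "q \<in> cube_nbrs p" "v \<in> cube_nbrs q" using p q by auto
  then show False using cube_nbrs_parity by blast
qed

section \<open>Vertices and edges of the unit cube\<close>

definition cube_vertex :: "bool \<times> bool \<times> bool \<Rightarrow> real ^ 3" where
  "cube_vertex = (\<lambda>(a, b, c). vector [of_bool a, of_bool b, of_bool c])"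

lemma mem_unit_cube: "x \<in> cbox 0 One \<longleftrightarrow> (\<forall>i. 0 \<le> x $ i \<and> x $ i \<le> (1::real))" for x :: "real ^ 'n"
proof -
  have "(\<forall>b\<in>Basis. Q (x \<bullet> b)) \<longleftrightarrow> (\<forall>i. Q (x $ i))" for Q
    by (auto simp: Basis_vec_def inner_axis)
  from this[of "\<lambda>r. 0 \<le> r \<and> r \<le> 1"] show ?thesis
    by (simp add: mem_box)
qed

text \<open>Fixing some coordinates to 0 or 1 gives a face. All coordinates give the vertices, all but one
  the edges.\<close>
lemma unit_cube_face:
  assumes "\<And>j. j \<in> J \<Longrightarrow> u $ j \<in> {0, 1::real}"
  shows "{x \<in> cbox 0 One. \<forall>j\<in>J. x $ j = u $ j} face_of (cbox 0 One :: (real ^ 'n) set)"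
    (is "?E face_of ?C")
proof -
  have *: "a $ j = u $ j \<and> b $ j = u $ j"
    if ab: "a \<in> ?C" "b \<in> ?C" "x \<in> open_segment a b" and x: "x \<in> ?E" "j \<in> J" for a b x j
  proof -
    obtain t where t: "0 < t" "t < 1" "x = (1 - t) *\<^sub>R a + t *\<^sub>R b"
      using ab(3) by (auto simp: in_segment)
    have b: "0 \<le> a $ j" "a $ j \<le> 1" "0 \<le> b $ j" "b $ j \<le> 1" using ab by (auto simp: mem_unit_cube)
    have e: "u $ j = (1 - t) * a $ j + t * b $ j" using t x by auto
    have "u $ j = 0 \<or> u $ j = 1" using assms x by blast
    then show ?thesis
    proof
      assume "u $ j = 0"
      with e b t show ?thesis by (simp add: add_nonneg_eq_0_iff)
    next
      assume 1: "u $ j = 1"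
      have "(1 - t) * (1 - a $ j) + t * (1 - b $ j) = 0" using e 1 by (simp add: algebra_simps)
      then have "(1 - t) * (1 - a $ j) = 0 \<and> t * (1 - b $ j) = 0"
        using b t by (subst (asm) add_nonneg_eq_0_iff) auto
      then show ?thesis using t 1 by auto
    qed
  qed
  have "convex ?E"
  proof -
    have "?E = ?C \<inter> (\<Inter>j\<in>J. {x. x $ j = u $ j})" by auto
    moreover have "convex {x. x $ j = u $ j}" for j
      using convex_hyperplane[of "axis j 1 :: real ^ 'n" "u $ j"] by (simp add: inner_axis')
    ultimately show ?thesis by (simp add: convex_Int convex_INT)
  qed
  then show ?thesis unfolding face_of_def using * by blast
qed

lemma cube_vertex_nth: "cube_vertex p $ i \<in> {0, 1}"
  using exhaust_3[of i] by (auto simp: cube_vertex_def split: prod.splits)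

lemma cube_vertex_extreme: "cube_vertex p extreme_point_of cbox 0 One"
proof -
  have "{x \<in> cbox 0 One. \<forall>j\<in>UNIV. x $ j = cube_vertex p $ j} = {cube_vertex p}"
  proof -
    have "0 \<le> cube_vertex p $ i \<and> cube_vertex p $ i \<le> 1" for i
      using cube_vertex_nth[of p i] by auto
    then show ?thesis by (auto simp: mem_unit_cube vec_eq_iff)
  qed
  then show ?thesis
    using unit_cube_face[of UNIV "cube_vertex p"] cube_vertex_nth[of p] by (simp add: face_of_singleton)
qed

lemma inj_cube_vertex: "inj cube_vertex"
  by (auto simp: inj_def cube_vertex_def vec_eq_iff forall_3)

text \<open>A point with a coordinate strictly between 0 and 1 is the midpoint of a short segment parallel
  to that axis.\<close>
lemma extreme_point_of_unit_cube:
  assumes x: "x extreme_point_of (cbox 0 One :: (real ^ 'n) set)"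
  shows "x $ i \<in> {0, 1}"
proof (rule ccontr)
  assume ne: "x $ i \<notin> {0, 1}"
  have xc: "x \<in> cbox 0 One" using x by (simp add: extreme_point_of_def)
  define e where "e = min (x $ i) (1 - x $ i)"
  have e: "0 < e" "e \<le> x $ i" "e \<le> 1 - x $ i" 
    using xc ne unfolding mem_unit_cube e_def by (auto simp: min_def less_eq_real_def)
  define a where "a = x - e *\<^sub>R axis i 1"
  define b where "b = x + e *\<^sub>R axis i 1"
  have "a \<in> cbox 0 One" "b \<in> cbox 0 One"
    using xc e by (auto simp: mem_unit_cube a_def b_def axis_def add_nonneg_nonneg
       intro: order_trans)
  moreover have "x = midpoint a b" by (simp add: a_def b_def midpoint_def algebra_simps flip: scaleR_2)
  moreover have "a \<noteq> b" using e by (auto simp: a_def b_def vec_eq_iff axis_def)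
  ultimately show False using x by (metis extreme_point_of_def midpoint_in_open_segment)
qed

lemma extreme_points_unit_cube: "{x. x extreme_point_of (cbox 0 One :: (real ^ 3) set)} = range cube_vertex"
proof (intro subset_antisym subsetI)
  fix x assume "x \<in> {x. x extreme_point_of (cbox 0 One :: (real ^ 3) set)}"
  then have "x = cube_vertex (x $ 1 = 1, x $ 2 = 1, x $ 3 = 1)"
    using extreme_point_of_unit_cube[of x] by (auto simp: cube_vertex_def vec_eq_iff forall_3)
  then show "x \<in> range cube_vertex" by blast
qed (auto simp: cube_vertex_extreme)

lemma ex_3: "(\<exists>i::3. Q i) \<longleftrightarrow> Q 1 \<or> Q 2 \<or> Q 3"
  by (metis exhaust_3)

lemma cube_nbrs_edge:
  assumes "q \<in> cube_nbrs p"
  shows "closed_segment (cube_vertex p) (cube_vertex q) edge_of cbox 0 One"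
proof -
  have "\<exists>i. cube_vertex q $ i \<noteq> cube_vertex p $ i \<and> (\<forall>j. j \<noteq> i \<longrightarrow> cube_vertex q $ j = cube_vertex p $ j)"
  proof -
    obtain a b c where p: "p = (a, b, c)" by (cases p)
    show ?thesis
      using assms unfolding p ex_3 forall_3 by (auto simp: cube_nbrs_def cube_vertex_def)
  qed
  then obtain i where i: "cube_vertex q $ i \<noteq> cube_vertex p $ i"
    "\<And>j. j \<noteq> i \<Longrightarrow> cube_vertex q $ j = cube_vertex p $ j" by blast
  let ?p = "cube_vertex p" and ?q = "cube_vertex q"
  have eq: "{x \<in> cbox 0 One. \<forall>j\<in>-{i}. x $ j = ?p $ j} = closed_segment ?p ?q" (is "?E = ?S")
  proof (intro subset_antisym subsetI)
    fix x assume "x \<in> ?S"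
    then obtain t where t: "x = (1 - t) *\<^sub>R ?p + t *\<^sub>R ?q" by (auto simp: in_segment)
    moreover have "x $ j = ?p $ j" if "j \<noteq> i" for j
      unfolding t by (simp add: i(2)[OF that] left_diff_distrib)
    ultimately show "x \<in> ?E"
      using closed_segment_subset[of ?p "cbox 0 One" ?q] cube_vertex_extreme[of p] cube_vertex_extreme[of q] \<open>x \<in> ?S\<close>
      by (auto simp: extreme_point_of_def)
  next
    fix x assume x: "x \<in> ?E"
    define t where "t = (if ?p $ i = 0 then x $ i else 1 - x $ i)"
    have "0 \<le> t" "t \<le> 1" using x by (auto simp: t_def mem_unit_cube)
    moreover have "x = (1 - t) *\<^sub>R ?p + t *\<^sub>R ?q"
      unfolding vec_eq_iff
    proof
      fix j
      show "x $ j = ((1 - t) *\<^sub>R ?p + t *\<^sub>R ?q) $ j"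
      proof (cases "j = i")
        case True
        then show ?thesis using i(1) cube_vertex_nth[of p i] cube_vertex_nth[of q i] by (auto simp: t_def)
      next
        case False
        then show ?thesis using x i(2) by (simp add: algebra_simps)
      qed
    qed
    ultimately show "x \<in> ?S" by (auto simp: in_segment)
  qed
  have "?p \<noteq> ?q" using i(1) by auto
  then show ?thesis
    using unit_cube_face[of "-{i}" ?p] cube_vertex_nth[of p]
    by (auto simp: edge_of_def eq segment_convex_hull aff_dim_convex_hull)
qed

section \<open>Vertex maps induced by combinatorial equivalence\<close>

text \<open>Vertices are the atoms of the face lattice, hence visible to any order isomorphism.\<close>
lemma atomic_face_iff:
  fixes P :: "'a::euclidean_space set"
  assumes P: "polytope P" and E: "E face_of P"
  shows "(\<exists>x. E = {x}) \<longleftrightarrow> E \<noteq> {} \<and> (\<forall>D. D face_of P \<and> D \<subseteq> E \<longrightarrow> D = {} \<or> D = E)"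
proof (intro iffI conjI)
  assume R: "E \<noteq> {} \<and> (\<forall>D. D face_of P \<and> D \<subseteq> E \<longrightarrow> D = {} \<or> D = E)"
  have "polytope E" using face_of_polytope_polytope[OF P E] .
  then obtain x where "x extreme_point_of E"
    using extreme_point_exists_convex[of E] R polytope_imp_compact polytope_imp_convex by blast
  then have "{x} face_of P" "{x} \<subseteq> E"
    using extreme_point_of_face[OF E] by (auto simp: face_of_singleton)
  then show "\<exists>x. E = {x}" using R by blast
qed auto

lemma combinatorially_equivalent_sym:
  assumes "combinatorially_equivalent P Q"
  shows "combinatorially_equivalent Q P"
proof -
  obtain f where f: "bij_betw f {F. F face_of P} {G. G face_of Q}"
    "\<And>F G. F face_of P \<Longrightarrow> G face_of P \<Longrightarrow> f F \<subseteq> f G \<longleftrightarrow> F \<subseteq> G"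
    using assms unfolding combinatorially_equivalent_def by blast
  define g where "g = the_inv_into {F. F face_of P} f"
  have g: "bij_betw g {G. G face_of Q} {F. F face_of P}"
    unfolding g_def by (rule bij_betw_the_inv_into[OF f(1)])
  have fg: "f (g G) = G" "g G face_of P" if "G face_of Q" for G
    using that f_the_inv_into_f_bij_betw[OF f(1), of G] g by (auto simp: g_def bij_betw_def)
  have "g F \<subseteq> g G \<longleftrightarrow> F \<subseteq> G" if "F face_of Q" "G face_of Q" for F G
    using f(2)[of "g F" "g G"] fg that by simp
  then show ?thesis unfolding combinatorially_equivalent_def using g by blast
qed

text \<open>A lattice isomorphism sends atoms to atoms, which gives the map on vertices. The image of an
  edge is a face with exactly two vertices, and a polytope is the hull of its vertices, so this
  image is the segment between them.\<close>
lemma combinatorially_equivalent_vertex_map: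
  fixes P :: "'a::euclidean_space set" and Q :: "'b::euclidean_space set"
  assumes P: "polytope P" and Q: "polytope Q" and "combinatorially_equivalent P Q"
  obtains \<phi> where "bij_betw \<phi> {u. u extreme_point_of P} {v. v extreme_point_of Q}"
    "\<And>u w. closed_segment u w edge_of P \<Longrightarrow> closed_segment (\<phi> u) (\<phi> w) edge_of Q"
proof -
  obtain f where f: "bij_betw f {F. F face_of P} {G. G face_of Q}"
    and le: "\<And>F G. F face_of P \<Longrightarrow> G face_of P \<Longrightarrow> f F \<subseteq> f G \<longleftrightarrow> F \<subseteq> G"
    using assms unfolding combinatorially_equivalent_def by blast
  have ff: "f F face_of Q" if "F face_of P" for F using f that by (auto simp: bij_betw_def)
  have onto: "\<exists>F. F face_of P \<and> f F = G" if "G face_of Q" for G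
  proof -
    have "G \<in> f ` {F. F face_of P}" using f that by (simp add: bij_betw_def)
    then show ?thesis by blast
  qed
  have inj: "F = G" if "F face_of P" "G face_of P" "f F = f G" for F G
    using le[of F G] le[of G F] that by blast
  have f0: "f {} = {}"
  proof -
    obtain F where "F face_of P" "f F = {}" using onto[of "{}"] by auto
    then show ?thesis using le[of "{}" F] by auto
  qed
  have atom: "(\<exists>x. E = {x}) \<longleftrightarrow> (\<exists>y. f E = {y})" if E: "E face_of P" for E
  proof -
    have "(\<forall>D. D face_of P \<and> D \<subseteq> E \<longrightarrow> D = {} \<or> D = E)
       \<longleftrightarrow> (\<forall>D. D face_of Q \<and> D \<subseteq> f E \<longrightarrow> D = {} \<or> D = f E)" (is "?L \<longleftrightarrow> ?R")
    proof
      assume L: ?L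
      show ?R
      proof (intro allI impI)
        fix D assume D: "D face_of Q \<and> D \<subseteq> f E"
        then obtain F where F: "F face_of P" "f F = D" using onto by blast
        then have "F \<subseteq> E" using le[OF F(1) E] D by simp
        then have "F = {} \<or> F = E" using L F by blast
        then show "D = {} \<or> D = f E" using F f0 by auto
      qed
    next
      assume R: ?R
      show ?L
      proof (intro allI impI)
        fix D assume D: "D face_of P \<and> D \<subseteq> E"
        then have "f D = {} \<or> f D = f E" using R ff le[of D E] E by blast
        then show "D = {} \<or> D = E" using inj[of D "{}"] inj[of D E] D E f0 by auto
      qed
    qed
    moreover have "E = {} \<longleftrightarrow> f E = {}" using f0 inj[of E "{}"] E by auto
    ultimately show ?thesis
      unfolding atomic_face_iff[OF P E] atomic_face_iff[OF Q ff[OF E]] by simp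
  qed
  define \<phi> where "\<phi> u = the_elem (f {u})" for u
  have \<phi>: "f {u} = {\<phi> u}" "\<phi> u extreme_point_of Q" if u: "u extreme_point_of P" for u
  proof -
    have uP: "{u} face_of P" using u by (simp add: face_of_singleton)
    obtain y where "f {u} = {y}" using atom[OF uP] by blast
    then show "f {u} = {\<phi> u}" by (simp add: \<phi>_def)
    then show "\<phi> u extreme_point_of Q" using ff[OF uP] by (simp add: face_of_singleton)
  qed
  have surj: "\<exists>u. u extreme_point_of P \<and> \<phi> u = v" if v: "v extreme_point_of Q" for v
  proof -
    have "{v} face_of Q" using v by (simp add: face_of_singleton)
    then obtain E where E: "E face_of P" "f E = {v}" using onto by blast
    then obtain u where "E = {u}" using atom[OF E(1)] by blast
    then have u: "u extreme_point_of P" using E by (simp add: face_of_singleton)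
    moreover have "\<phi> u = v" using \<phi>(1)[OF u] E \<open>E = {u}\<close> by simp
    ultimately show ?thesis by blast
  qed
  have inj\<phi>: "u = w" if "u extreme_point_of P" "w extreme_point_of P" "\<phi> u = \<phi> w" for u w
    using inj[of "{u}" "{w}"] \<phi>(1)[of u] \<phi>(1)[of w] that by (simp add: face_of_singleton)
  have bij: "bij_betw \<phi> {u. u extreme_point_of P} {v. v extreme_point_of Q}"
    unfolding bij_betw_def inj_on_def using inj\<phi> \<phi>(2) surj by blast
  have "closed_segment (\<phi> u) (\<phi> w) edge_of Q" if e: "closed_segment u w edge_of P" for u w
  proof -
    let ?E = "closed_segment u w"
    have E: "?E face_of P" using e by (simp add: edge_of_def)
    have ux: "u extreme_point_of P" "w extreme_point_of P" "u \<noteq> w"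
      using edge_ends_extreme[OF e] by blast+
    have "{v. v extreme_point_of f ?E} = {\<phi> u, \<phi> w}"
    proof (intro subset_antisym subsetI)
      fix v assume "v \<in> {v. v extreme_point_of f ?E}"
      then have v: "v extreme_point_of Q" "v \<in> f ?E"
        using extreme_point_of_face[OF ff[OF E]] by auto
      then obtain x where x: "x extreme_point_of P" "\<phi> x = v" using surj by blast
      have "{x} \<subseteq> ?E" using le[of "{x}" ?E] x v E \<phi>(1)[OF x(1)] by (simp add: face_of_singleton)
      then have "x extreme_point_of ?E" using x extreme_point_of_face[OF E] by simp
      then show "v \<in> {\<phi> u, \<phi> w}" using x by (auto simp: extreme_point_of_segment)
    next
      fix v assume "v \<in> {\<phi> u, \<phi> w}"
      then obtain x where x: "x \<in> {u, w}" "v = \<phi> x" by blast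
      then have xP: "x extreme_point_of P" using ux by blast
      have "{v} \<subseteq> f ?E" using le[of "{x}" ?E] x xP E \<phi>(1)[OF xP] by (auto simp: face_of_singleton)
      then show "v \<in> {v. v extreme_point_of f ?E}"
        using extreme_point_of_face[OF ff[OF E]] \<phi>(2)[OF xP] x by simp
    qed
    then have "f ?E = closed_segment (\<phi> u) (\<phi> w)"
      using polytope_hull_extreme[OF face_of_polytope_polytope[OF Q ff[OF E]]]
      by (simp add: segment_convex_hull)
    moreover have "\<phi> u \<noteq> \<phi> w" using inj\<phi> ux by blast
    ultimately show ?thesis
      using ff[OF E] by (simp add: edge_of_def segment_convex_hull aff_dim_convex_hull)
  qed
  then show ?thesis using that bij by blast
qed

lemma cube_facet_one_pair_joined:
  fixes F :: "'a::euclidean_space set"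
  assumes F: "polytope F" and cube: "combinatorially_equivalent F (cbox 0 One :: (real ^ 3) set)"
    and ext: "{v, s1, t1, s2, t2} \<subseteq> {x. x extreme_point_of F}" and d: "distinct [v, s1, t1, s2, t2]"
  shows "joined_within F ({x. x extreme_point_of F} - {v, s2, t2}) s1 t1
       \<or> joined_within F ({x. x extreme_point_of F} - {v, s1, t1}) s2 t2"
proof -
  obtain \<phi> where \<phi>: "bij_betw \<phi> {u. u extreme_point_of (cbox 0 One :: (real ^ 3) set)} {x. x extreme_point_of F}"
    "\<And>u w. closed_segment u w edge_of (cbox 0 One :: (real ^ 3) set) \<Longrightarrow> closed_segment (\<phi> u) (\<phi> w) edge_of F"
    using combinatorially_equivalent_vertex_map[OF polytope_interval F combinatorially_equivalent_sym[OF cube]]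
    by blast
  define h where "h p = \<phi> (cube_vertex p)" for p
  have "bij_betw (\<phi> \<circ> cube_vertex) UNIV {x. x extreme_point_of F}"
    using \<phi>(1) unfolding extreme_points_unit_cube
    by (intro bij_betw_trans[of cube_vertex UNIV "range cube_vertex"] inj_on_imp_bij_betw inj_cube_vertex)
  then have h: "inj h" "range h = {x. x extreme_point_of F}"
    by (simp_all add: bij_betw_def h_def[abs_def] comp_def)
  have edge: "closed_segment (h p) (h q) edge_of F" if "q \<in> cube_nbrs p" for p q
    unfolding h_def using that cube_nbrs_edge \<phi>(2) by blast
  have lift: "joined_within F ({x. x extreme_point_of F} - h ` S) (h p) (h q)" if "cube_joined S p q" for S p q
    using that
  proof (induction rule: rtranclp_induct)
    case (step y z)
    have "joined_within F ({x. x extreme_point_of F} - h ` S) (h y) (h z)"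
      using step(2) h edge by (intro joined_within_edge) (auto simp: inj_image_mem_iff)
    with step.IH show ?case by (rule joined_within_trans)
  qed simp
  have "{v, s1, t1, s2, t2} \<subseteq> range h"
    using ext h(2) by simp
  then obtain v' s1' t1' s2' t2' where eq: "v = h v'" "s1 = h s1'" "t1 = h t1'" "s2 = h s2'" "t2 = h t2'"
    unfolding insert_subset image_iff by blast
  have "distinct [v', s1', t1', s2', t2']" using d unfolding eq by auto
  from cube_one_pair_joined[OF this] show ?thesis
    using lift[of "{v', s2', t2'}" s1' t1'] lift[of "{v', s1', t1'}" s2' t2'] unfolding eq by auto
qed

section \<open>From edge connections to paths\<close>

lemma joined_within_vpath:
  fixes P :: "'a::euclidean_space set"
  assumes "joined_within P A s t" "s \<in> A" "A \<subseteq> {x. x extreme_point_of P}" "v \<notin> A"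
  shows "\<exists>p. vpath p (pre_digraph.del_vert (polytope_graph P) v) \<and> hd p = s \<and> last p = t \<and> set p \<subseteq> A"
proof -
  let ?G = "pre_digraph.del_vert (polytope_graph P) v"
  have verts: "x \<in> verts ?G" if "x \<in> A" for x
    using that assms by (auto simp: pre_digraph.verts_del_vert polytope_graph_def)
  have arc: "(x, y) \<in> arcs_ends ?G" if "closed_segment x y edge_of P" "x \<in> A" "y \<in> A" for x y
    using that assms(4)
    by (auto simp: arcs_ends_def arc_to_ends_def pre_digraph.del_vert_def polytope_graph_def with_proj_def
        intro!: image_eqI[of _ _ "(x, y)"])
  have "\<exists>p. vwalk p ?G \<and> hd p = s \<and> last p = t \<and> set p \<subseteq> A"
    using assms(1,2) unfolding joined_within_def
  proof (induction rule: converse_rtranclp_induct)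
    case base
    then show ?case using verts by (intro exI[of _ "[t]"]) auto
  next
    case (step y z)
    then obtain p where p: "vwalk p ?G" "hd p = z" "last p = t" "set p \<subseteq> A" by blast
    then have "p \<noteq> []" by auto
    then have "vwalk (y # p) ?G"
      using p(1,2) arc[of y z] verts[of y] step.hyps(1) by (cases p) (auto simp: vwalk_def)
    with p \<open>p \<noteq> []\<close> step show ?case by (intro exI[of _ "y # p"]) auto
  qed
  then obtain p where p: "vwalk p ?G" "hd p = s" "last p = t" "set p \<subseteq> A" by blast
  moreover have "set (vwalk_to_vpath p) \<subseteq> A"
    using vwalk_to_vpath_subset[of _ p] p(4) by (intro subsetI) (rule subsetD)
  ultimately show ?thesis
    using vwalk_to_vpath_vpath[OF p(1)]
    by (intro exI[of _ "vwalk_to_vpath p"]) (auto simp: vwalk_to_vpath_hd vwalk_to_vpath_last)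
qed

section \<open>Disjoint connections in a cubical 4-polytope\<close>

text \<open>Prescribing the values 1 and -1 on four independent vectors separates the pairs. For dependent
  vectors the span of \<open>B\<close> is smaller than the 4-dimensional direction space of \<open>P\<close>; a direction of
  that space orthogonal to \<open>B\<close> is constant on the five points but, not being orthogonal to itself,
  varies on \<open>P\<close>.\<close>
lemma separated_or_cohyperplanar:
  fixes P :: "'a::euclidean_space set"
  assumes dim: "aff_dim P = 4" and P: "{v, s1, t1, s2, t2} \<subseteq> P" and d: "distinct [v, s1, t1, s2, t2]"
  obtains (separated) a where "a \<bullet> v < a \<bullet> s1" "a \<bullet> v < a \<bullet> t1" "a \<bullet> s2 < a \<bullet> v" "a \<bullet> t2 < a \<bullet> v"
  | (cohyperplanar) a y where "y \<in> P" "a \<bullet> y \<noteq> a \<bullet> v" "\<And>x. x \<in> {s1, t1, s2, t2} \<Longrightarrow> a \<bullet> x = a \<bullet> v"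
proof -
  define B where "B = {s1 - v, t1 - v, s2 - v, t2 - v}"
  show ?thesis
  proof (cases "independent B")
    case True
    define f where "f x = (if x \<in> {s1 - v, t1 - v} then 1 else - 1 :: real)" for x
    obtain g where g: "linear g" "\<And>x. x \<in> B \<Longrightarrow> g x = f x"
      using linear_independent_extend[OF True, of f] by blast
    define a where "a = adjoint g 1"
    have "a \<bullet> x - a \<bullet> v = f (x - v)" if "x \<in> {s1, t1, s2, t2}" for x
    proof -
      have "a \<bullet> (x - v) = g (x - v)"
        using adjoint_works[OF g(1), of "x - v" 1] by (simp add: a_def inner_commute)
      also have "\<dots> = f (x - v)" using that by (intro g(2)) (auto simp: B_def)
      finally show ?thesis by (simp add: inner_diff_right)
    qed
    note this[of s1] this[of t1] this[of s2] this[of t2]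
    moreover have "f (s1 - v) = 1" "f (t1 - v) = 1" "f (s2 - v) = - 1" "f (t2 - v) = - 1"
      using d by (auto simp: f_def)
    ultimately show ?thesis by (intro separated[of a]) auto
  next
    case False
    define T where "T = (\<lambda>x. x - v) ` P"
    have "v \<in> affine hull P" using P hull_subset[of P affine] by blast
    then have dimT: "dim T = 4" using dim aff_dim_eq_dim_subtract[of v P] by (simp add: T_def)
    have "finite B" by (simp add: B_def)
    then have "dim B < card B"
      using card_le_dim_spanning[of B B] False span_superset[of B] by fastforce
    moreover have "card B \<le> 4"
      unfolding B_def by (intro order_trans[OF card_insert_le_m1]) auto
    ultimately have "span B \<noteq> span T" using dimT by (metis dim_span not_less)
    moreover have "B \<subseteq> T" using P by (auto simp: B_def T_def)
    ultimately have "span B \<subset> span T" using span_mono[of B T] by blast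
    then obtain a where a: "a \<noteq> 0" "a \<in> span T" "\<And>x. x \<in> span B \<Longrightarrow> orthogonal a x"
      using orthogonal_to_subspace_exists_gen by blast
    have "\<exists>y\<in>T. \<not> orthogonal a y"
      using orthogonal_to_span[OF a(2), of a] a(1) by (auto simp: orthogonal_self)
    then obtain y where y: "y \<in> P" "\<not> orthogonal a (y - v)" by (auto simp: T_def)
    have "a \<bullet> x = a \<bullet> v" if "x \<in> {s1, t1, s2, t2}" for x
    proof -
      have "x - v \<in> span B" using that by (intro span_base) (auto simp: B_def)
      then show ?thesis using a(3)[of "x - v"] by (simp add: orthogonal_def inner_diff_right)
    qed
    moreover have "a \<bullet> y \<noteq> a \<bullet> v" using y(2) by (simp add: orthogonal_def inner_diff_right)
    ultimately show ?thesis using cohyperplanar[of y a] y(1) by blast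
  qed
qed

definition linkage_avoiding :: "'a::euclidean_space set \<Rightarrow> 'a \<Rightarrow> 'a \<Rightarrow> 'a \<Rightarrow> 'a \<Rightarrow> 'a \<Rightarrow> bool" where
  "linkage_avoiding P v s1 t1 s2 t2 \<longleftrightarrow>
     (\<exists>A B. A \<union> B \<subseteq> {x. x extreme_point_of P} - {v} \<and> A \<inter> B = {} \<and> s1 \<in> A \<and> s2 \<in> B \<and>
        joined_within P A s1 t1 \<and> joined_within P B s2 t2)"

lemma linkage_avoiding_swap:
  assumes "linkage_avoiding P v s1 t1 s2 t2"
  shows "linkage_avoiding P v s2 t2 s1 t1"
proof -
  obtain A B where "A \<union> B \<subseteq> {x. x extreme_point_of P} - {v}" "A \<inter> B = {}" "s1 \<in> A" "s2 \<in> B"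
    "joined_within P A s1 t1" "joined_within P B s2 t2"
    using assms unfolding linkage_avoiding_def by blast
  then show ?thesis
    unfolding linkage_avoiding_def by (intro exI[of _ B] exI[of _ A]) auto
qed

text \<open>The second pair is joined off the facet, on the inner side of its supporting hyperplane. That
  walk meets \<open>F\<close> only in \<open>s2\<close> and \<open>t2\<close>, which the connection inside \<open>F\<close> avoids.\<close>
lemma linkage_through_facet:
  fixes P :: "'a::euclidean_space set"
  assumes P: "polytope P" and F: "F facet_of P"
    and ext: "{s1, t1, s2, t2} \<subseteq> {x. x extreme_point_of F}" and d: "distinct [v, s1, t1, s2, t2]"
    and inside: "joined_within F ({x. x extreme_point_of F} - {v, s2, t2}) s1 t1" and v: "v \<in> F"
  shows "linkage_avoiding P v s1 t1 s2 t2"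
proof -
  have FP: "F face_of P" "F \<noteq> P" using F by (auto simp: facet_of_imp_face_of)
  have "F exposed_face_of P"
    using FP(1) exposed_face_of_polyhedron[OF polytope_imp_polyhedron[OF P]] by simp
  then obtain a b where ab: "P \<subseteq> {x. a \<bullet> x \<le> b}" "F = P \<inter> {x. a \<bullet> x = b}"
    unfolding exposed_face_of_def by blast
  obtain y where y: "y \<in> P" "- b < (- a) \<bullet> y"
  proof -
    obtain y where "y \<in> P" "y \<notin> F" using FP face_of_imp_subset by blast
    then have "a \<bullet> y \<le> b" "a \<bullet> y \<noteq> b" using ab by auto
    then show ?thesis using that[of y] \<open>y \<in> P\<close> by simp
  qed
  have extP: "x extreme_point_of P" "x \<in> F" "(- a) \<bullet> x = - b" if "x extreme_point_of F" for x
  proof -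
    show "x extreme_point_of P" "x \<in> F" using that extreme_point_of_face[OF FP(1)] by auto
    then show "(- a) \<bullet> x = - b" using ab by simp
  qed
  define A where "A = {x. x extreme_point_of F} - {v, s2, t2}"
  define B where "B = {s2, t2} \<union> {z. z extreme_point_of P \<and> - b < (- a) \<bullet> z}"
  have "joined_within P B s2 t2"
    unfolding B_def using extP[of s2] extP[of t2] ext
    by (intro joined_beyond_hyperplane[OF P _ _ _ _ y]) auto
  moreover have "joined_within P A s1 t1"
    unfolding A_def using joined_within_face[OF inside FP(1)] .
  moreover have "A \<subseteq> {x. x extreme_point_of P} - {v}"
    unfolding A_def using extP(1) by blast
  moreover have "B \<subseteq> {x. x extreme_point_of P} - {v}"
    using v ab(2) extP(1)[of s2] extP(1)[of t2] ext d by (auto simp: B_def)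
  moreover have "A \<inter> B = {}"
  proof (intro equals0I)
    fix z assume z: "z \<in> A \<inter> B"
    then have "(- a) \<bullet> z = - b" by (intro extP(3)) (simp add: A_def)
    with z show False by (auto simp: A_def B_def)
  qed
  moreover have "s1 \<in> A" "s2 \<in> B" using ext d by (auto simp: A_def B_def)
  ultimately show ?thesis
    unfolding linkage_avoiding_def by (intro exI[of _ A] exI[of _ B]) auto
qed

lemma cubical_4_polytope_linkage:
  fixes P :: "'a::euclidean_space set"
  assumes cub: "cubical_4_polytope P" and ext: "{v, s1, t1, s2, t2} \<subseteq> {x. x extreme_point_of P}"
    and d: "distinct [v, s1, t1, s2, t2]"
  shows "linkage_avoiding P v s1 t1 s2 t2"
proof -
  have P: "polytope P" and dim: "aff_dim P = 4"
    and cube: "\<And>F. F facet_of P \<Longrightarrow> combinatorially_equivalent F (cbox 0 One :: (real ^ 3) set)"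
    using cub by (auto simp: cubical_4_polytope_def)
  have sub: "{v, s1, t1, s2, t2} \<subseteq> P" using ext by (auto simp: extreme_point_of_def)
  from dim sub d show ?thesis
  proof (cases rule: separated_or_cohyperplanar)
    case (separated a)
    define A where "A = {z. z extreme_point_of P \<and> a \<bullet> v < a \<bullet> z}"
    define B where "B = {z. z extreme_point_of P \<and> - (a \<bullet> v) < (- a) \<bullet> z}"
    have "joined_within P A s1 t1" "joined_within P B s2 t2"
      unfolding A_def B_def using ext separated by (intro open_halfspace_joined[OF P]; simp)+
    moreover have "A \<union> B \<subseteq> {x. x extreme_point_of P} - {v}" "A \<inter> B = {}" "s1 \<in> A" "s2 \<in> B"
      using ext separated by (auto simp: A_def B_def)
    ultimately show ?thesis unfolding linkage_avoiding_def by blast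
  next
    case (cohyperplanar a y)
    show ?thesis
    proof (cases "(\<exists>z\<in>P. a \<bullet> v < a \<bullet> z) \<and> (\<exists>z\<in>P. a \<bullet> z < a \<bullet> v)")
      case True
      then obtain z z' where z: "z \<in> P" "a \<bullet> v < a \<bullet> z" "z' \<in> P" "- (a \<bullet> v) < (- a) \<bullet> z'" by auto
      define A where "A = {s1, t1} \<union> {z. z extreme_point_of P \<and> a \<bullet> v < a \<bullet> z}"
      define B where "B = {s2, t2} \<union> {z. z extreme_point_of P \<and> - (a \<bullet> v) < (- a) \<bullet> z}"
      have "joined_within P A s1 t1"
        unfolding A_def using ext cohyperplanar(3) by (intro joined_beyond_hyperplane[OF P _ _ _ _ z(1,2)]) auto
      moreover have "joined_within P B s2 t2"
        unfolding B_def using ext cohyperplanar(3) by (intro joined_beyond_hyperplane[OF P _ _ _ _ z(3,4)]) auto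
      moreover have "A \<union> B \<subseteq> {x. x extreme_point_of P} - {v}" "A \<inter> B = {}" "s1 \<in> A" "s2 \<in> B"
        using ext d cohyperplanar(3) by (auto simp: A_def B_def)
      ultimately show ?thesis unfolding linkage_avoiding_def by blast
    next
      case False
      \<comment> \<open>the hyperplane supports \<open>P\<close>, so the five vertices share a facet\<close>
      define E where "E = P \<inter> {x. a \<bullet> x = a \<bullet> v}"
      have "(\<forall>x\<in>P. a \<bullet> x \<le> a \<bullet> v) \<or> (\<forall>x\<in>P. a \<bullet> x \<ge> a \<bullet> v)" using False by force
      then have E: "E face_of P"
        unfolding E_def using polytope_imp_convex[OF P]
        by (auto intro: face_of_Int_supporting_hyperplane_le face_of_Int_supporting_hyperplane_ge)
      have subE: "{v, s1, t1, s2, t2} \<subseteq> E" using sub cohyperplanar(3) by (auto simp: E_def)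
      have "E \<noteq> P" using cohyperplanar(1,2) by (auto simp: E_def)
      then obtain F where F: "F facet_of P" "E \<subseteq> F"
        using face_of_polyhedron_subset_facet[OF polytope_imp_polyhedron[OF P] E] subE by blast
      have FP: "F face_of P" using F(1) by (rule facet_of_imp_face_of)
      have extF: "{v, s1, t1, s2, t2} \<subseteq> {x. x extreme_point_of F}"
        using ext subE F(2) extreme_point_of_face[OF FP] by blast
      from cube_facet_one_pair_joined[OF face_of_polytope_polytope[OF P FP] cube[OF F(1)] extF d]
      show ?thesis
      proof
        assume "joined_within F ({x. x extreme_point_of F} - {v, s2, t2}) s1 t1"
        then show ?thesis using P F(1) extF d subE F(2) by (intro linkage_through_facet[of P F]) auto
      next
        assume "joined_within F ({x. x extreme_point_of F} - {v, s1, t1}) s2 t2"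
        then have "linkage_avoiding P v s2 t2 s1 t1"
          using P F(1) extF d subE F(2) by (intro linkage_through_facet[of P F]) auto
        then show ?thesis by (rule linkage_avoiding_swap)
      qed
    qed
  qed
qed

lemma card_vertices_ge:
  fixes P :: "'a::euclidean_space set"
  assumes "polytope P"
  shows "aff_dim P + 1 \<le> card {v. v extreme_point_of P}"
proof -
  have "aff_dim P = aff_dim {v. v extreme_point_of P}"
    using polytope_hull_extreme[OF assms] by (metis aff_dim_convex_hull)
  then show ?thesis using aff_dim_le_card[OF polytope_finite_extreme[OF assms]] by simp
qed

theorem theorem16:
  fixes P :: "'a::euclidean_space set"
  assumes "cubical_4_polytope P"
  shows "strongly_k_linked 2 (polytope_graph P)"
proof -
  have P: "polytope P" "aff_dim P = 4" using assms by (auto simp: cubical_4_polytope_def)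
  have verts: "verts (polytope_graph P) = {x. x extreme_point_of P}"
    by (simp add: polytope_graph_def)
  have card: "5 \<le> card {x. x extreme_point_of P}" using card_vertices_ge[OF P(1)] P(2) by simp
  have "k_linked 2 (pre_digraph.del_vert (polytope_graph P) v)" (is "k_linked 2 ?G")
    if v: "v extreme_point_of P" for v
  proof -
    have vG: "verts ?G = {x. x extreme_point_of P} - {v}" by (simp add: pre_digraph.verts_del_vert verts)
    have two: "{..<2::nat} = {0, 1}" by auto
    have "\<exists>L. (\<forall>i<2. vpath (L i) ?G \<and> hd (L i) = s i \<and> last (L i) = t i) \<and>
             disjoint_family_on (\<lambda>i. set (L i)) {..<2::nat}"
      if st: "s ` {..<2} \<subseteq> verts ?G" "t ` {..<2} \<subseteq> verts ?G" "inj_on s {..<2}" "inj_on t {..<2}"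
        "s ` {..<2} \<inter> t ` {..<2} = {}" for s t :: "nat \<Rightarrow> 'a"
    proof -
      have "{v, s 0, t 0, s 1, t 1} \<subseteq> {x. x extreme_point_of P}" "distinct [v, s 0, t 0, s 1, t 1]"
        using st v unfolding two vG by (auto simp: inj_on_def)
      from cubical_4_polytope_linkage[OF assms this]
      obtain A B where AB: "A \<union> B \<subseteq> {x. x extreme_point_of P} - {v}" "A \<inter> B = {}" "s 0 \<in> A" "s 1 \<in> B"
        "joined_within P A (s 0) (t 0)" "joined_within P B (s 1) (t 1)"
        unfolding linkage_avoiding_def by blast
      obtain p where p: "vpath p ?G" "hd p = s 0" "last p = t 0" "set p \<subseteq> A"
        using joined_within_vpath[OF AB(5,3)] AB(1) by blast
      obtain q where q: "vpath q ?G" "hd q = s 1" "last q = t 1" "set q \<subseteq> B"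
        using joined_within_vpath[OF AB(6,4)] AB(1) by blast
      show ?thesis
        using p q AB(2)
        by (intro exI[of _ "\<lambda>i. if i = 0 then p else q"])
          (auto simp: disjoint_family_on_def less_2_cases_iff)
    qed
    moreover have "4 \<le> card (verts ?G)"
      using card v polytope_finite_extreme[OF P(1)] by (simp add: vG)
    ultimately show ?thesis unfolding k_linked_def by simp
  qed
  then show ?thesis using card by (simp add: strongly_k_linked_def verts)
qed

end
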